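(* Let $3\le r\le 8$ and $1\le a\le 3$. Each divisor class $D\in Pic\,S_r$ with $D^2=-a$ and $K_{S_r}\cdot D=-a$ can be written as a sum $D=l_1+\dots+l_a$ of skew lines $l_1,\dots,l_a$, and the choice of $l_1,\dots,l_a$ is unique up to permutation.
   Context: $S_r$ is a del Pezzo surface obtained by blowing up $\mathbb{P}^2$ at $r$ points in general position. $Pic\,S_r=\mathbb{Z}h\oplus\mathbb{Z}e_1\oplus\dots\oplus\mathbb{Z}e_r$ with $h^2=1$, $h\cdot e_i=0$, $e_i\cdot e_j=-\delta_{ij}$, and $K_{S_r}=-3h+\sum_{i=1}^r e_i$. A line is a class $l\in Pic\,S_r$ with $l^2=l\cdot K_{S_r}=-1$; distinct lines $l,l'$ are skew if $l\cdot l'=0$, and "skew lines $l_1,\dots,l_a$" means pairwise distinct and pairwise skew. *)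

theory Defs
  imports "HOL-Library.Multiset" "HOL-Library.Poly_Mapping"
begin

text \<open>
  The Picard group of the blow-up of the projective plane at \<open>r\<close> points is free abelian on
  \<open>h\<close> (the pullback of the class of a line) and \<open>e\<^sub>1, \<dots>, e\<^sub>r\<close> (the exceptional
  classes). \<open>Poly_Mapping\<close> provides the free abelian group on a set of generators; the classes on
  \<open>S\<^sub>r\<close> are the elements supported on \<open>H, E 1, \<dots>, E r\<close>.
\<close>

datatype pic_gen = H | E nat

type_synonym divisor_class = "pic_gen \<Rightarrow>\<^sub>0 int"

definition Pic :: "nat \<Rightarrow> divisor_class set" where
  "Pic r = {D. Poly_Mapping.keys D \<subseteq> insert H (E ` {1..r})}"

definition hclass :: divisor_class where
  "hclass = frag_of H"

definition eclass :: "nat \<Rightarrow> divisor_class" where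
  "eclass i = frag_of (E i)"

text \<open>
  The bilinear form with \<open>h \<cdot> h = 1\<close>, \<open>h \<cdot> e\<^sub>i = 0\<close> and
  \<open>e\<^sub>i \<cdot> e\<^sub>j = - \<delta>\<^sub>i\<^sub>j\<close>; see \<open>inter_num_basis\<close> and the bilinearity lemmas below.
\<close>

definition inter_num :: "nat \<Rightarrow> divisor_class \<Rightarrow> divisor_class \<Rightarrow> int" where
  "inter_num r D D' =
     poly_mapping.lookup D H * poly_mapping.lookup D' H
     - (\<Sum>i=1..r. poly_mapping.lookup D (E i) * poly_mapping.lookup D' (E i))"

definition canonical_class :: "nat \<Rightarrow> divisor_class" where
  "canonical_class r = frag_cmul (-3) hclass + (\<Sum>i=1..r. eclass i)"

definition is_line :: "nat \<Rightarrow> divisor_class \<Rightarrow> bool" where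
  "is_line r l \<longleftrightarrow> l \<in> Pic r \<and> inter_num r l l = -1 \<and> inter_num r l (canonical_class r) = -1"

definition skew_lines :: "nat \<Rightarrow> divisor_class list \<Rightarrow> bool" where
  "skew_lines r ls \<longleftrightarrow>
     (\<forall>l \<in> set ls. is_line r l) \<and> distinct ls \<and> pairwise (\<lambda>l l'. inter_num r l l' = 0) (set ls)"

lemma inter_num_basis:
  "inter_num r hclass hclass = 1"
  "inter_num r hclass (eclass i) = 0"
  "i \<in> {1..r} \<Longrightarrow> inter_num r (eclass i) (eclass j) = (if i = j then -1 else 0)"
  by (auto simp: inter_num_def hclass_def eclass_def if_distrib[of "\<lambda>x. _ * x"]
      if_distrib[of "\<lambda>x. x * _"] cong: if_cong)

lemma inter_num_commute: "inter_num r D D' = inter_num r D' D"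
  by (simp add: inter_num_def mult.commute)

lemma inter_num_add_left: "inter_num r (D + D') F = inter_num r D F + inter_num r D' F"
  by (simp add: inter_num_def lookup_add algebra_simps sum.distrib)

lemma inter_num_cmul_left: "inter_num r (frag_cmul c D) F = c * inter_num r D F"
  by (simp add: inter_num_def algebra_simps sum_distrib_left)

lemma Pic_basis:
  assumes "D \<in> Pic r"
  shows "D = frag_cmul (poly_mapping.lookup D H) hclass
           + (\<Sum>i=1..r. frag_cmul (poly_mapping.lookup D (E i)) (eclass i))"
proof (rule poly_mapping_eqI)
  fix g
  show "poly_mapping.lookup D g = poly_mapping.lookup
          (frag_cmul (poly_mapping.lookup D H) hclass
           + (\<Sum>i=1..r. frag_cmul (poly_mapping.lookup D (E i)) (eclass i))) g"
  proof (cases g)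
    case H
    then show ?thesis
      by (simp add: lookup_add lookup_sum hclass_def eclass_def)
  next
    case (E j)
    have "poly_mapping.lookup D (E j) = 0" if "j \<notin> {1..r}"
      using assms that by (auto simp: Pic_def in_keys_iff)
    with E show ?thesis
      by (auto simp: lookup_add lookup_sum hclass_def eclass_def
          if_distrib[of "\<lambda>x. _ * x"] cong: if_cong)
  qed
qed

end

theory Submission
  imports Defs "HOL-Analysis.Convex"
begin

text \<open>
  Everything rests on the Hodge index theorem: for \<open>r \<le> 8\<close> the form is negative definite on the
  orthogonal complement of \<open>K\<close>, which here is the Cauchy--Schwarz inequality
  (\<open>orthogonal_canonical_square_nonneg_imp_zero\<close>). If \<open>D\<^sup>2 = K \<cdot> D = -a\<close> and \<open>l\<close> is a line, then
  \<open>D - a l\<close> is orthogonal to \<open>K\<close>, and computing its square for \<open>a \<le> 3\<close> gives \<open>D \<cdot> l \<ge> -1\<close>. This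
  is where \<open>a \<le> 3\<close> matters. The same computation for the difference of two distinct lines shows that
  they meet nonnegatively.

  Uniqueness follows because \<open>D\<close> remembers the summands: if \<open>D\<close> is a sum of skew lines, then a line
  \<open>l\<close> satisfies \<open>D \<cdot> l = -1\<close> when it is one of them and \<open>D \<cdot> l \<ge> 0\<close> otherwise.

  For existence it is enough to find one line \<open>l\<close> with \<open>D \<cdot> l < 0\<close>, hence \<open>D \<cdot> l = -1\<close>: then
  \<open>D - l\<close> has the same numerical type for \<open>a - 1\<close> and is orthogonal to \<open>l\<close>, so a
  decomposition of \<open>D - l\<close> consists of lines skew to \<open>l\<close>. To find \<open>l\<close>
  (\<open>negative_line_exists\<close>), write \<open>D = d h - \<Sum> b\<^sub>i e\<^sub>i\<close>, where \<open>d \<ge> 0\<close> by Cauchy--Schwarz. If some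
  \<open>b\<^sub>i < 0\<close>, take \<open>l = e\<^sub>i\<close>. If some \<open>b\<^sub>i + b\<^sub>j + b\<^sub>k > d\<close>, the reflection in the root
  \<open>h - e\<^sub>i - e\<^sub>j - e\<^sub>k\<close> (a quadratic Cremona transformation) lowers \<open>d\<close> and permutes the lines, so
  induction applies. Otherwise \<open>D\<close> lies in the fundamental chamber of the Weyl group, where
  \<open>\<Sum> b\<^sub>i\<^sup>2 \<le> d\<^sup>2\<close>, contradicting \<open>D\<^sup>2 = -a < 0\<close>.
\<close>

section \<open>The intersection form\<close>

lemma inter_num_add_right: "inter_num r F (D + D') = inter_num r F D + inter_num r F D'"
  by (metis inter_num_add_left inter_num_commute)

lemma inter_num_cmul_right: "inter_num r F (frag_cmul c D) = c * inter_num r F D"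
  by (metis inter_num_cmul_left inter_num_commute)

lemma inter_num_diff_left: "inter_num r (D - D') F = inter_num r D F - inter_num r D' F"
  by (metis add_diff_cancel diff_add_cancel inter_num_add_left)

lemma inter_num_diff_right: "inter_num r F (D - D') = inter_num r F D - inter_num r F D'"
  by (metis inter_num_commute inter_num_diff_left)

lemma inter_num_zero_left [simp]: "inter_num r 0 F = 0"
  by (simp add: inter_num_def)

lemmas inter_num_bilinear =
  inter_num_add_left inter_num_add_right inter_num_cmul_left inter_num_cmul_right
  inter_num_diff_left inter_num_diff_right

lemma inter_num_hclass: "inter_num r D hclass = poly_mapping.lookup D H"
  by (simp add: inter_num_def hclass_def)

lemma inter_num_eclass:
  assumes "i \<in> {1..r}"
  shows "inter_num r D (eclass i) = - poly_mapping.lookup D (E i)"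
  using assms by (simp add: inter_num_def eclass_def if_distrib[of "\<lambda>x. _ * x"] cong: if_cong)

lemma inter_num_canonical_class:
  "inter_num r D (canonical_class r)
    = - 3 * poly_mapping.lookup D H - (\<Sum>i=1..r. poly_mapping.lookup D (E i))"
proof -
  have "poly_mapping.lookup (canonical_class r) (E i) = 1" if "i \<in> {1..r}" for i
    using that by (simp add: canonical_class_def hclass_def eclass_def lookup_add lookup_sum)
  moreover have "poly_mapping.lookup (canonical_class r) H = - 3"
    by (simp add: canonical_class_def hclass_def eclass_def lookup_add lookup_sum)
  ultimately show ?thesis
    by (simp add: inter_num_def)
qed

lemma in_Pic_iff: "D \<in> Pic r \<longleftrightarrow> (\<forall>i. i \<notin> {1..r} \<longrightarrow> poly_mapping.lookup D (E i) = 0)"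
proof
  assume *: "\<forall>i. i \<notin> {1..r} \<longrightarrow> poly_mapping.lookup D (E i) = 0"
  show "D \<in> Pic r"
    unfolding Pic_def
  proof (intro CollectI subsetI)
    fix g assume "g \<in> Poly_Mapping.keys D"
    then show "g \<in> insert H (E ` {1..r})"
      using * by (cases g) (auto simp: in_keys_iff simp del: atLeastAtMost_iff)
  qed
qed (auto simp: Pic_def in_keys_iff)

lemma Pic_add: "D \<in> Pic r \<Longrightarrow> F \<in> Pic r \<Longrightarrow> D + F \<in> Pic r"
  by (simp add: in_Pic_iff lookup_add)

lemma Pic_diff: "D \<in> Pic r \<Longrightarrow> F \<in> Pic r \<Longrightarrow> D - F \<in> Pic r"
  by (simp add: in_Pic_iff lookup_minus)

lemma Pic_cmul: "D \<in> Pic r \<Longrightarrow> frag_cmul c D \<in> Pic r"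
  by (simp add: in_Pic_iff)

lemma Pic_hclass: "hclass \<in> Pic r"
  by (simp add: in_Pic_iff hclass_def)

lemma Pic_eclass: "i \<in> {1..r} \<Longrightarrow> eclass i \<in> Pic r"
  by (auto simp: in_Pic_iff eclass_def)

section \<open>Negative definiteness on the orthogonal complement of the canonical class\<close>

text \<open>
  This is Cauchy--Schwarz for the vector of the \<open>e\<^sub>i\<close>-coefficients of \<open>D\<close> and the vector
  \<open>(1, \<dots>, 1)\<close>: the left side is the square of their scalar product, the right side is \<open>8 \<ge> r\<close>
  times the sum of the squared coefficients. It bounds the degree \<open>D \<cdot> h\<close> when \<open>D\<^sup>2\<close> and
  \<open>K \<cdot> D\<close> are given.
\<close>

lemma degree_bound:
  assumes "r \<le> 8"
  shows "(3 * poly_mapping.lookup D H + inter_num r D (canonical_class r))\<^sup>2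
          \<le> 8 * ((poly_mapping.lookup D H)\<^sup>2 - inter_num r D D)"
proof -
  let ?x = "\<lambda>i. poly_mapping.lookup D (E i)"
  have "(\<Sum>i=1..r. real_of_int (?x i))\<^sup>2 \<le> (\<Sum>i=1..r. (real_of_int (?x i))\<^sup>2) * r"
    using sum_squared_le_sum_of_squares[of "\<lambda>i. real_of_int (?x i)" "{1..r}"] by simp
  then have "real_of_int ((\<Sum>i=1..r. ?x i)\<^sup>2) \<le> real_of_int ((\<Sum>i=1..r. (?x i)\<^sup>2) * int r)"
    by simp
  then have "(\<Sum>i=1..r. ?x i)\<^sup>2 \<le> (\<Sum>i=1..r. (?x i)\<^sup>2) * int r"
    by (simp only: of_int_le_iff)
  also have "\<dots> \<le> (\<Sum>i=1..r. (?x i)\<^sup>2) * 8"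
    using assms by (intro mult_left_mono sum_nonneg) auto
  finally show ?thesis
    unfolding inter_num_canonical_class by (simp add: inter_num_def power2_eq_square)
qed

text \<open>
  For \<open>K \<cdot> F = 0\<close> the degree bound reads \<open>9 d\<^sup>2 \<le> 8 (d\<^sup>2 - F\<^sup>2)\<close>, so \<open>F\<^sup>2 \<ge> 0\<close> forces first
  \<open>d = 0\<close> and then all other coefficients to vanish.
\<close>

lemma orthogonal_canonical_square_nonneg_imp_zero:
  assumes "r \<le> 8" and "F \<in> Pic r"
    and "inter_num r F (canonical_class r) = 0" and "0 \<le> inter_num r F F"
  shows "F = 0"
proof -
  have "9 * (poly_mapping.lookup F H)\<^sup>2 \<le> 8 * ((poly_mapping.lookup F H)\<^sup>2 - inter_num r F F)"
    using degree_bound[OF assms(1), of F] assms(3) by (simp add: power_mult_distrib)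
  then have "(poly_mapping.lookup F H)\<^sup>2 \<le> 0"
    using assms(4) by (simp only: right_diff_distrib)
  then have H0: "poly_mapping.lookup F H = 0"
    by simp
  then have "(\<Sum>i=1..r. (poly_mapping.lookup F (E i))\<^sup>2) \<le> 0"
    using assms(4) by (simp add: inter_num_def power2_eq_square)
  then have "(\<Sum>i=1..r. (poly_mapping.lookup F (E i))\<^sup>2) = 0"
    by (simp add: sum_nonneg order_antisym)
  then have "\<forall>i\<in>{1..r}. poly_mapping.lookup F (E i) = 0"
    by (simp add: sum_nonneg_eq_0_iff)
  then have "poly_mapping.lookup F g = 0" for g
    using H0 assms(2) by (cases g) (auto simp: in_Pic_iff)
  then show ?thesis
    by (simp add: poly_mapping_eqI)
qed

section \<open>Classes with the numerical type of a sum of skew lines\<close>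

definition numerical_skew_sum :: "nat \<Rightarrow> nat \<Rightarrow> divisor_class \<Rightarrow> bool" where
  "numerical_skew_sum r a D \<longleftrightarrow> D \<in> Pic r \<and> inter_num r D D = - int a
     \<and> inter_num r D (canonical_class r) = - int a"

lemma is_line_iff_numerical_skew_sum: "is_line r l \<longleftrightarrow> numerical_skew_sum r 1 l"
  by (simp add: is_line_def numerical_skew_sum_def)

text \<open>
  With \<open>m = - D \<cdot> l\<close>, the class \<open>D - a l\<close> lies in the complement of \<open>K\<close> and has square
  \<open>a (2 m - 1 - a)\<close>, which is nonnegative as soon as \<open>m \<ge> 2\<close> and \<open>a \<le> 3\<close>. Negative definiteness then
  leaves only \<open>D = a l\<close>, whose square \<open>-a\<^sup>2\<close> is not \<open>-a\<close> unless \<open>a = 1\<close>, and then \<open>m = 1\<close>.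
\<close>

lemma inter_num_line_ge:
  assumes "r \<le> 8" and "1 \<le> a" and "a \<le> 3"
    and D: "numerical_skew_sum r a D" and l: "is_line r l"
  shows "- 1 \<le> inter_num r D l"
proof (rule ccontr)
  assume "\<not> ?thesis"
  then have m: "inter_num r D l \<le> - 2" by simp
  let ?F = "D - frag_cmul (int a) l"
  have "inter_num r ?F ?F = - int a - 2 * int a * inter_num r D l - int a * int a"
    using D l by (simp add: inter_num_bilinear inter_num_commute[of r l D]
        numerical_skew_sum_def is_line_def algebra_simps)
  also have "\<dots> = int a * (- 1 - 2 * inter_num r D l - int a)"
    by (simp add: algebra_simps)
  also have "\<dots> \<ge> 0"
    using m assms(3) by (intro mult_nonneg_nonneg) auto
  finally have "?F = 0"
    using assms(1) D l
    by (intro orthogonal_canonical_square_nonneg_imp_zero)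
       (auto simp: inter_num_bilinear numerical_skew_sum_def is_line_def Pic_diff Pic_cmul)
  then have "D = frag_cmul (int a) l" by simp
  then have "inter_num r D l = - int a" and "inter_num r D D = - int a * int a"
    using l by (simp_all add: inter_num_bilinear is_line_def)
  moreover from this(2) have "int a = 1"
    using D assms(2) by (simp add: numerical_skew_sum_def)
  ultimately show False
    using m by simp
qed

text \<open>The difference of two lines is orthogonal to \<open>K\<close>, with square \<open>-2 - 2 l \<cdot> l'\<close>.\<close>

lemma distinct_lines_inter_num_nonneg:
  assumes "r \<le> 8" and l: "is_line r l" and l': "is_line r l'" and "l \<noteq> l'"
  shows "0 \<le> inter_num r l l'"
proof (rule ccontr)
  assume "\<not> ?thesis"
  then have "0 \<le> inter_num r (l - l') (l - l')"
    using l l' by (simp add: inter_num_bilinear inter_num_commute[of r l' l] is_line_def)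
  then have "l - l' = 0"
    using assms(1) l l'
    by (intro orthogonal_canonical_square_nonneg_imp_zero)
       (auto simp: inter_num_bilinear is_line_def Pic_diff)
  then show False
    using \<open>l \<noteq> l'\<close> by simp
qed

section \<open>Lines are determined by their sum\<close>

lemma inter_num_sum_list_left:
  "inter_num r (sum_list ls) F = (\<Sum>l\<leftarrow>ls. inter_num r l F)"
  by (induction ls) (simp_all add: inter_num_add_left)

lemma skew_lines_Cons:
  "skew_lines r (m # ls) \<longleftrightarrow>
     is_line r m \<and> m \<notin> set ls \<and> (\<forall>l\<in>set ls. inter_num r m l = 0) \<and> skew_lines r ls"
  by (auto simp: skew_lines_def pairwise_insert) (metis inter_num_commute)+

lemma inter_num_sum_member:
  assumes "skew_lines r ls" and "l \<in> set ls"
  shows "inter_num r (sum_list ls) l = - 1"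
  using assms
proof (induction ls)
  case (Cons m ls)
  have "inter_num r l' m = 0" if "l' \<in> set ls" for l'
    using Cons.prems(1) that by (metis inter_num_commute skew_lines_Cons)
  then have orth: "inter_num r (sum_list ls) m = 0"
    by (simp add: inter_num_sum_list_left cong: map_cong)
  show ?case
    using Cons orth by (auto simp: skew_lines_Cons inter_num_add_left is_line_def)
qed simp

lemma inter_num_sum_nonmember:
  assumes "r \<le> 8" and "skew_lines r ls" and "is_line r l" and "l \<notin> set ls"
  shows "0 \<le> inter_num r (sum_list ls) l"
  unfolding inter_num_sum_list_left
  using assms by (intro sum_list_nonneg)
    (auto simp: skew_lines_def intro!: distinct_lines_inter_num_nonneg)

lemma skew_lines_unique:
  assumes "r \<le> 8" and ls: "skew_lines r ls" and ls': "skew_lines r ls'"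
    and eq: "sum_list ls = sum_list ls'"
  shows "mset ls = mset ls'"
proof -
  have *: "set ms \<subseteq> set ns"
    if "skew_lines r ms" "skew_lines r ns" "sum_list ms = sum_list ns" for ms ns
  proof
    fix l assume "l \<in> set ms"
    then have "is_line r l" and "inter_num r (sum_list ns) l = - 1"
      using that inter_num_sum_member[of r ms l] by (auto simp: skew_lines_def)
    then show "l \<in> set ns"
      using inter_num_sum_nonmember[OF assms(1) that(2)] by fastforce
  qed
  have "set ls = set ls'"
    using *[OF ls ls'] *[OF ls' ls] eq by auto
  then show ?thesis
    using ls ls' by (simp add: skew_lines_def set_eq_iff_mset_eq_distinct)
qed

section \<open>The fundamental chamber\<close>

text \<open>
  Only the three largest coefficients \<open>p \<ge> q \<ge> c\<close> matter: the other ones are at most \<open>c\<close>, so they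
  contribute at most \<open>c\<close> times their sum. The difference of the two sides of the resulting
  inequality is a polynomial with nonnegative coefficients in \<open>c\<close>, \<open>q - c\<close>, \<open>p - q\<close> and
  \<open>d - p - q - c\<close>, all of which are nonnegative in the chamber.
\<close>

lemma sum_squares_le_in_fundamental_chamber:
  fixes b :: "'a \<Rightarrow> int"
  assumes "finite I" and "3 \<le> card I" and nonneg: "\<And>i. i \<in> I \<Longrightarrow> 0 \<le> b i"
    and total: "sum b I \<le> 3 * d"
    and triple: "\<And>i j k. \<lbrakk>i \<in> I; j \<in> I; k \<in> I; i \<noteq> j; i \<noteq> k; j \<noteq> k\<rbrakk> \<Longrightarrow> b i + b j + b k \<le> d"
  shows "(\<Sum>i\<in>I. (b i)\<^sup>2) \<le> d\<^sup>2"
proof -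
  have max: "\<exists>i\<in>J. \<forall>j\<in>J. b j \<le> b i" if "J \<subseteq> I" "J \<noteq> {}" for J
  proof -
    have "finite J"
      using that(1) assms(1) finite_subset by blast
    then have "Max (b ` J) \<in> b ` J" "\<forall>j\<in>J. b j \<le> Max (b ` J)"
      using that(2) by auto
    then show ?thesis by (metis imageE)
  qed
  have "I \<noteq> {}"
    using assms(2) by auto
  then obtain i where i: "i \<in> I" "\<forall>m\<in>I. b m \<le> b i"
    using max[of I] by auto
  have "card (I - {i}) \<ge> 2"
    using i assms(1,2) by simp
  then have "I - {i} \<noteq> {}"
    by (metis card.empty not_numeral_le_zero)
  then obtain j where j: "j \<in> I - {i}" "\<forall>m\<in>I - {i}. b m \<le> b j"
    using max[of "I - {i}"] by auto
  have "card (I - {i} - {j}) \<ge> 1"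
    using j \<open>card (I - {i}) \<ge> 2\<close> assms(1) by simp
  then have "I - {i} - {j} \<noteq> {}"
    by (metis card.empty not_one_le_zero)
  then obtain k where k: "k \<in> I - {i} - {j}" "\<forall>m\<in>I - {i} - {j}. b m \<le> b k"
    using max[of "I - {i} - {j}"] by auto
  let ?R = "I - {i} - {j}"
  have split: "sum f I = f i + f j + sum f ?R" for f :: "'a \<Rightarrow> int"
    using sum.remove[OF assms(1) i(1), of f] sum.remove[of "I - {i}" j f] j assms(1) by simp
  have "(\<Sum>m\<in>?R. (b m)\<^sup>2) \<le> (\<Sum>m\<in>?R. b k * b m)"
    unfolding power2_eq_square using k nonneg by (intro sum_mono mult_right_mono) auto
  also have "\<dots> = b k * sum b ?R"
    by (simp add: sum_distrib_left)
  also have "\<dots> \<le> b k * (3 * d - b i - b j)"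
    using split[of b] total nonneg k by (intro mult_left_mono) auto
  finally have "(\<Sum>m\<in>I. (b m)\<^sup>2) \<le> (b i)\<^sup>2 + (b j)\<^sup>2 + b k * (3 * d - b i - b j)"
    using split[of "\<lambda>m. (b m)\<^sup>2"] by simp
  also have "\<dots> \<le> d\<^sup>2"
  proof -
    define c u v w where "c = b k" and "u = b j - b k" and "v = b i - b j"
      and "w = d - b i - b j - b k"
    have pos: "0 \<le> c" "0 \<le> u" "0 \<le> v" "0 \<le> w"
      using i j k nonneg triple[of i j k] by (auto simp: c_def u_def v_def w_def)
    have eqs: "b k = c" "b j = c + u" "b i = c + u + v" "d = 3 * c + 2 * u + v + w"
      by (simp_all add: c_def u_def v_def w_def)
    have "d\<^sup>2 - ((b i)\<^sup>2 + (b j)\<^sup>2 + b k * (3 * d - b i - b j))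
      = 2*(u*u) + w*w + 4*(c*u) + 2*(c*v) + 3*(c*w) + 2*(u*v) + 4*(u*w) + 2*(v*w)"
      unfolding eqs by (simp add: power2_eq_square algebra_simps)
    also have "\<dots> \<ge> 0"
      using pos by (intro add_nonneg_nonneg mult_nonneg_nonneg) auto
    finally show ?thesis by simp
  qed
  finally show ?thesis .
qed

section \<open>Cremona reflections\<close>

definition reflection :: "nat \<Rightarrow> divisor_class \<Rightarrow> divisor_class \<Rightarrow> divisor_class" where
  "reflection r \<alpha> D = D + frag_cmul (inter_num r D \<alpha>) \<alpha>"

text \<open>
  Self-adjointness carries a line that is negative on the reflected class back to one that is
  negative on the original class.
\<close>

lemma inter_num_reflection_swap:
  "inter_num r (reflection r \<alpha> D) F = inter_num r D (reflection r \<alpha> F)"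
  by (simp add: reflection_def inter_num_bilinear inter_num_commute[of r \<alpha> F])

lemma numerical_skew_sum_reflection:
  assumes "\<alpha> \<in> Pic r" and "inter_num r \<alpha> \<alpha> = - 2" and "inter_num r \<alpha> (canonical_class r) = 0"
    and "numerical_skew_sum r a D"
  shows "numerical_skew_sum r a (reflection r \<alpha> D)"
  using assms
  by (simp add: numerical_skew_sum_def reflection_def inter_num_bilinear
      inter_num_commute[of r \<alpha> D] Pic_add Pic_cmul)

definition cremona_root :: "nat \<Rightarrow> nat \<Rightarrow> nat \<Rightarrow> divisor_class" where
  "cremona_root i j k = hclass - eclass i - eclass j - eclass k"

lemma cremona_root:
  assumes "i \<in> {1..r}" "j \<in> {1..r}" "k \<in> {1..r}" "i \<noteq> j" "i \<noteq> k" "j \<noteq> k"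
  shows "cremona_root i j k \<in> Pic r"
    and "inter_num r (cremona_root i j k) (cremona_root i j k) = - 2"
    and "inter_num r (cremona_root i j k) (canonical_class r) = 0"
proof -
  show "cremona_root i j k \<in> Pic r"
    using assms by (simp add: cremona_root_def Pic_diff Pic_hclass Pic_eclass)
  show "inter_num r (cremona_root i j k) (cremona_root i j k) = - 2"
    using assms by (simp add: cremona_root_def inter_num_bilinear inter_num_basis
        inter_num_commute[of r "eclass _" hclass])
  have "inter_num r hclass (canonical_class r) = - 3"
    by (simp add: inter_num_canonical_class hclass_def)
  moreover have "inter_num r (eclass m) (canonical_class r) = - 1" if "m \<in> {1..r}" for m
    using that by (simp add: inter_num_canonical_class eclass_def)
  ultimately show "inter_num r (cremona_root i j k) (canonical_class r) = 0"
    using assms by (simp add: cremona_root_def inter_num_diff_left)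
qed

lemma is_line_eclass: "i \<in> {1..r} \<Longrightarrow> is_line r (eclass i)"
  by (simp add: is_line_def Pic_eclass inter_num_basis inter_num_canonical_class)
     (simp add: eclass_def)

section \<open>Existence of a negative line\<close>

text \<open>
  Makes the descent on the degree below terminate. The degree bound for \<open>d = -e\<close> can be rewritten as
  \<open>(e\<^sup>2 - 1) + 6 a (e - 1) + (a - 1)\<^sup>2 \<le> 0\<close>, which is impossible for \<open>e \<ge> 1\<close> and \<open>a \<ge> 2\<close>.
\<close>

lemma degree_nonneg:
  assumes "r \<le> 8" and "2 \<le> a" and D: "numerical_skew_sum r a D"
  shows "0 \<le> poly_mapping.lookup D H"
proof (rule ccontr)
  assume neg: "\<not> ?thesis"
  define e where "e = - poly_mapping.lookup D H"
  define n where "n = int a"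
  have e: "1 \<le> e" and n: "2 \<le> n"
    using neg assms(2) by (auto simp: e_def n_def)
  have "(3 * e + n)\<^sup>2 \<le> 8 * (e\<^sup>2 + n)"
    using degree_bound[OF assms(1), of D] D
    by (simp add: e_def n_def numerical_skew_sum_def power2_eq_square algebra_simps)
  then have "(e - 1) * (e + 1) + 6 * n * (e - 1) + (n - 1)\<^sup>2 \<le> 0"
    by (simp add: power2_eq_square algebra_simps)
  moreover have "0 \<le> (e - 1) * (e + 1)" "0 \<le> 6 * n * (e - 1)" "0 < (n - 1)\<^sup>2"
    using e n by auto
  ultimately show False by linarith
qed

text \<open>
  Descent on the degree \<open>d\<close>: because \<open>D\<^sup>2 < 0\<close>, a class with all \<open>b\<^sub>i \<ge> 0\<close> lies outside the fundamental
  chamber, on the wrong side of the wall of some root \<open>h - e\<^sub>i - e\<^sub>j - e\<^sub>k\<close>, and reflecting in it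
  changes \<open>d\<close> by \<open>d - b\<^sub>i - b\<^sub>j - b\<^sub>k < 0\<close>.
\<close>

lemma negative_line_exists:
  assumes "3 \<le> r" and "r \<le> 8" and "2 \<le> a" and "numerical_skew_sum r a D"
  shows "\<exists>l. is_line r l \<and> inter_num r D l < 0"
  using assms(4)
proof (induction "nat (poly_mapping.lookup D H)" arbitrary: D rule: less_induct)
  case less
  let ?d = "poly_mapping.lookup D H"
  let ?b = "\<lambda>i. inter_num r D (eclass i)"
  show ?case
  proof (cases "\<exists>i\<in>{1..r}. ?b i < 0")
    case True
    then show ?thesis
      using is_line_eclass by blast
  next
    case nonneg: False
    have lookup: "poly_mapping.lookup D (E i) = - ?b i" if "i \<in> {1..r}" for i
      using inter_num_eclass[OF that, of D] by simp
    have "sum ?b {1..r} = 3 * ?d - int a"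
      using less.prems
      by (simp add: numerical_skew_sum_def inter_num_canonical_class lookup sum_negf)
    then have total: "sum ?b {1..r} \<le> 3 * ?d" by simp
    have squares: "(\<Sum>i=1..r. (?b i)\<^sup>2) = ?d\<^sup>2 + int a"
      using less.prems
      by (simp add: numerical_skew_sum_def inter_num_def[of r D D] lookup power2_eq_square)
    have "\<exists>i\<in>{1..r}. \<exists>j\<in>{1..r}. \<exists>k\<in>{1..r}.
        i \<noteq> j \<and> i \<noteq> k \<and> j \<noteq> k \<and> ?d < ?b i + ?b j + ?b k"
    proof (rule ccontr)
      assume small: "\<not> ?thesis"
      have "(\<Sum>i\<in>{1..r}. (?b i)\<^sup>2) \<le> ?d\<^sup>2"
      proof (rule sum_squares_le_in_fundamental_chamber)
        show "0 \<le> ?b i" if "i \<in> {1..r}" for i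
          using nonneg that by (meson not_le)
        show "?b i + ?b j + ?b k \<le> ?d"
          if "i \<in> {1..r}" "j \<in> {1..r}" "k \<in> {1..r}" "i \<noteq> j" "i \<noteq> k" "j \<noteq> k" for i j k
          using small that by (meson not_le)
      qed (use total assms(1) in simp_all)
      then show False
        using squares assms(3) by simp
    qed
    then obtain i j k where ijk: "i \<in> {1..r}" "j \<in> {1..r}" "k \<in> {1..r}"
        "i \<noteq> j" "i \<noteq> k" "j \<noteq> k" and big: "?d < ?b i + ?b j + ?b k"
      by blast
    define \<alpha> where "\<alpha> = cremona_root i j k"
    note root = cremona_root[OF ijk, folded \<alpha>_def]
    let ?D' = "reflection r \<alpha> D"
    have D': "numerical_skew_sum r a ?D'"
      using numerical_skew_sum_reflection[OF root less.prems] .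
    have "poly_mapping.lookup \<alpha> H = 1"
      by (simp add: \<alpha>_def cremona_root_def hclass_def eclass_def lookup_minus)
    then have "poly_mapping.lookup ?D' H = ?d + inter_num r D \<alpha>"
      by (simp add: reflection_def lookup_add)
    also have "inter_num r D \<alpha> = ?d - ?b i - ?b j - ?b k"
      by (simp add: \<alpha>_def cremona_root_def inter_num_diff_right inter_num_hclass)
    finally have "poly_mapping.lookup ?D' H < ?d"
      using big by simp
    then have "nat (poly_mapping.lookup ?D' H) < nat ?d"
      using degree_nonneg[OF assms(2,3) D'] by simp
    from less.hyps[OF this D'] obtain l where "is_line r l" "inter_num r ?D' l < 0"
      by blast
    then have "is_line r (reflection r \<alpha> l)" "inter_num r D (reflection r \<alpha> l) < 0"
      using numerical_skew_sum_reflection[OF root, of 1 l]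
      by (simp_all add: is_line_iff_numerical_skew_sum inter_num_reflection_swap)
    then show ?thesis by blast
  qed
qed

section \<open>Decomposition into skew lines\<close>

text \<open>
  Splitting off a line \<open>l\<close> with \<open>D \<cdot> l = -1\<close> leaves a class orthogonal to \<open>l\<close>; since distinct lines
  meet nonnegatively, orthogonality to the sum of the remaining lines is orthogonality to each.
\<close>

lemma skew_lines_decomposition:
  assumes "3 \<le> r" and "r \<le> 8" and "1 \<le> a" and "a \<le> 3" and "numerical_skew_sum r a D"
  shows "\<exists>ls. length ls = a \<and> skew_lines r ls \<and> D = sum_list ls"
  using assms(3-5)
proof (induction a arbitrary: D rule: dec_induct)
  case base
  then have "length [D] = 1 \<and> skew_lines r [D] \<and> D = sum_list [D]"
    by (simp add: skew_lines_def is_line_iff_numerical_skew_sum)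
  then show ?case by blast
next
  case (step n)
  obtain l where l: "is_line r l" and "inter_num r D l < 0"
    using negative_line_exists[OF assms(1,2) _ step.prems(2)] step.hyps by auto
  then have Dl: "inter_num r D l = - 1"
    using inter_num_line_ge[OF assms(2) _ step.prems(1) step.prems(2) l] by simp
  have "numerical_skew_sum r n (D - l)"
    using step.prems(2) l Dl
    by (simp add: numerical_skew_sum_def is_line_def inter_num_bilinear
        inter_num_commute[of r l D] Pic_diff)
  then obtain ls where ls: "length ls = n" "skew_lines r ls" "D - l = sum_list ls"
    using step.IH step.prems(1) by force
  have orth: "inter_num r (sum_list ls) l = 0"
    using Dl l by (simp add: inter_num_diff_left is_line_def flip: ls(3))
  have new: "l \<notin> set ls"
    using inter_num_sum_member[OF ls(2)] orth by force
  have nonneg: "0 \<le> inter_num r m l" if "m \<in> set ls" for m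
    using that ls(2) l new
    by (intro distinct_lines_inter_num_nonneg[OF assms(2)]) (auto simp: skew_lines_def)
  have "\<forall>m\<in>set ls. inter_num r m l = 0"
    using orth nonneg sum_list_nonneg_eq_0_iff[of "map (\<lambda>m. inter_num r m l) ls"]
    by (auto simp: inter_num_sum_list_left)
  then have "skew_lines r (l # ls)"
    using l new ls(2) by (metis inter_num_commute skew_lines_Cons)
  moreover have "D = sum_list (l # ls)"
    by (simp flip: ls(3))
  ultimately show ?case
    using ls(1) by (intro exI[of _ "l # ls"]) simp
qed

theorem theorem11:
  fixes r a :: nat and D :: divisor_class
  assumes "3 \<le> r" and "r \<le> 8"
    and "1 \<le> a" and "a \<le> 3"
    and "D \<in> Pic r"
    and "inter_num r D D = - int a"
    and "inter_num r (canonical_class r) D = - int a"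
  shows "(\<exists>ls. length ls = a \<and> skew_lines r ls \<and> D = sum_list ls) \<and>
         (\<forall>ls ls'. length ls = a \<and> skew_lines r ls \<and> D = sum_list ls \<and>
                   length ls' = a \<and> skew_lines r ls' \<and> D = sum_list ls' \<longrightarrow>
                   mset ls = mset ls')"
proof -
  have "numerical_skew_sum r a D"
    using assms(5-7) by (simp add: numerical_skew_sum_def inter_num_commute[of r D "canonical_class r"])
  then show ?thesis
    using skew_lines_decomposition[OF assms(1-4)] skew_lines_unique[OF assms(2)] by blast
qed

end
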